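(* Let $\lambda$ be a positive integer and let $\lambda(J-I)=XY$ be a factorization into two $n\times n$ integral matrices $X$ and $Y$. Suppose also that $XJ=rJ$ for some positive integer $r$. Then $$Y=\frac{\lambda}{r}J-\lambda X^{-1}.$$
   Context: $I$ is the $n\times n$ identity matrix and $J$ is the $n\times n$ all-ones matrix. $X^{-1}$ denotes the inverse of $X$ over the rational numbers. *)

theory Defs
  imports "HOL-Analysis.Analysis"
begin

definition all_ones :: "'a::one ^ 'n ^ 'm" where
  "all_ones = (\<chi> i j. 1)"

(* The library's *s multiplies from the left by an entry of the vector, which for a matrix
   is a whole row, and *\<^sub>R only takes real scalars. *)
definition mat_smult :: "'a::times \<Rightarrow> 'a ^ 'n ^ 'm \<Rightarrow> 'a ^ 'n ^ 'm" (infixr "*\<^sub>m" 75) where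
  "c *\<^sub>m A = map_matrix (\<lambda>a. c * a) A"

abbreviation rat_matrix :: "int ^ 'n ^ 'm \<Rightarrow> rat ^ 'n ^ 'm" where
  "rat_matrix \<equiv> map_matrix rat_of_int"

end

theory Submission
  imports Defs
begin

text \<open>Over the rationals, \<open>X ** J = r J\<close> and \<open>X ** Y = \<lambda> (J - I)\<close> give
  \<open>X ** (J / r - Y / \<lambda>) = J - (J - I) = I\<close>, so \<open>J / r - Y / \<lambda>\<close> is the inverse of \<open>X\<close>.\<close>

text \<open>For square matrices over a field a right inverse is two-sided. As
  \<open>matrix_inv\<close> merely chooses some two-sided inverse, its value is pinned down by
  cancelling \<open>B ** A\<close>.\<close>

lemma matrix_inv_unique_right:
  fixes A B :: "'a::field ^ 'n ^ 'n"
  assumes "A ** B = mat 1"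
  shows "invertible A" "matrix_inv A = B"
proof -
  have BA: "B ** A = mat 1"
    using assms by (simp add: matrix_left_right_inverse)
  then show inv: "invertible A"
    using assms unfolding invertible_def by blast
  then have "A ** matrix_inv A = mat 1"
    unfolding invertible_def matrix_inv_def by (rule someI2_ex) blast
  then have "B ** (A ** matrix_inv A) = B"
    by simp
  then show "matrix_inv A = B"
    by (simp add: matrix_mul_assoc BA)
qed

theorem theorem1p4:
  fixes lam r :: int
    and X Y :: "int ^ 'n ^ 'n"
  assumes "lam > 0"
    and "lam *\<^sub>m (all_ones - mat 1) = X ** Y"
    and "r > 0"
    and "X ** (all_ones :: int ^ 'n ^ 'n) = r *\<^sub>m all_ones"
  shows "invertible (rat_matrix X) \<and>
    rat_matrix Y = (rat_of_int lam / rat_of_int r) *\<^sub>m all_ones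
      - rat_of_int lam *\<^sub>m matrix_inv (rat_matrix X)"
proof -
  let ?l = "rat_of_int lam" and ?r = "rat_of_int r"
  define B :: "rat ^ 'n ^ 'n" where "B = (\<chi> i j. 1 / ?r - rat_of_int (Y $ i $ j) / ?l)"
  \<comment> \<open>All columns of \<open>X ** all_ones\<close> equal the vector of row sums of
    \<open>X\<close>, so any entry of row \<open>i\<close> serves; the diagonal one is
    taken.\<close>
  have row_sum: "(\<Sum>k\<in>UNIV. X $ i $ k) = r" for i
    using arg_cong[OF assms(4), of "\<lambda>M. M $ i $ i"]
    by (simp add: matrix_matrix_mult_def all_ones_def mat_smult_def map_matrix_def)
  have entry: "(\<Sum>k\<in>UNIV. X $ i $ k * Y $ k $ j) = lam * (1 - (if i = j then 1 else 0))" for i j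
    using arg_cong[OF assms(2), of "\<lambda>M. M $ i $ j"]
    by (simp add: matrix_matrix_mult_def all_ones_def mat_smult_def map_matrix_def mat_def)
  have "(rat_matrix X ** B) $ i $ j = mat 1 $ i $ j" for i j
  proof -
    \<comment> \<open>The casts stay outside the sums so that the integer identities
      \<open>row_sum\<close> and \<open>entry\<close> can be substituted.\<close>
    have "(rat_matrix X ** B) $ i $ j =
        rat_of_int (\<Sum>k\<in>UNIV. X $ i $ k) / ?r - rat_of_int (\<Sum>k\<in>UNIV. X $ i $ k * Y $ k $ j) / ?l"
      by (simp add: matrix_matrix_mult_def B_def map_matrix_def right_diff_distrib
          sum_subtractf sum_divide_distrib)
    also have "\<dots> = mat 1 $ i $ j"
      unfolding row_sum entry using assms(1,3) by (simp add: mat_def)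
    finally show ?thesis .
  qed
  then have "rat_matrix X ** B = mat 1"
    by (simp add: vec_eq_iff)
  note inv = matrix_inv_unique_right[OF this]
  \<comment> \<open>This solves the definition of \<open>B\<close> for \<open>Y\<close>, using
    \<open>lam\<close> \<noteq> 0.\<close>
  have "rat_matrix Y = (?l / ?r) *\<^sub>m all_ones - ?l *\<^sub>m B"
    using assms(1)
    by (simp add: vec_eq_iff B_def mat_smult_def map_matrix_def all_ones_def right_diff_distrib)
  with inv show ?thesis
    by simp
qed

end
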